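(* Let $k\ge 1$ be an integer. The Fibonacci number $F_k$ can be written as a product of three repdigits (in base $10$), i.e. $$F_k=d_1\frac{10^\ell-1}{9}\cdot d_2\frac{10^m-1}{9}\cdot d_3\frac{10^n-1}{9}$$ for some integers $1\le d_1,d_2,d_3\le 9$ and $1\le \ell\le m\le n$, if and only if $F_k\in\{1,2,3,5,8,21,55,144\}$.
   Context: $(F_n)_{n\ge 0}$ is the Fibonacci sequence: $F_0=0$, $F_1=1$, $F_{n+2}=F_{n+1}+F_n$. A repdigit is a positive integer all of whose decimal digits are equal, i.e. a number $d\frac{10^m-1}{9}$ with $m\ge 1$, $1\le d\le 9$. *)

theory Defs
  imports "HOL-Number_Theory.Fib"
begin

definition repdigit :: "nat \<Rightarrow> nat \<Rightarrow> nat" where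
  "repdigit d m = d * ((10 ^ m - 1) div 9)"

end

(* Write R_e = (10^e - 1)/9 and F_k = D R_l R_m R_n with D a product of three digits.

   First, divisibility. A prime p > 9 dividing F_k divides some R_e with e in {l, m, n}, hence
   ord_p(10) divides e; conversely p | R_e forces the rank of apparition of p to divide k.
   Chasing 151, 101, 61, 41 and 271 around this loop, and using that 400 never divides D R_l R_m R_n,
   gives: none of 15, 20, 50 divides k, and neither 4 nor 5 divides an exponent.

   Second, congruences. Modulo 1111000 = 1000 * 1111 the repunit R_e with e >= 3 depends only on
   e mod 4, so R_l R_m R_n is one of 35 residues w. Each w is invertible modulo 101000 = 1000 * 101,
   so D <= 729 is recovered from F_k mod 101000, that is, from k mod 1500. Comparison modulo 11
   leaves the known solutions and four further families, which die modulo 10291 = 41 * 251. *)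

theory Submission
  imports Defs "HOL-Number_Theory.Number_Theory"
begin

section \<open>Finite checks of periodic sequences\<close>

text \<open>
  For evaluation by \<open>code_simp\<close> the test \<open>Q\<close> should be small or a partially applied constant:
  the simplifier revisits the body of an abstraction at every step of the cycle.
\<close>

function cycle_all :: "('s \<Rightarrow> 's) \<Rightarrow> (int \<Rightarrow> 's \<Rightarrow> bool) \<Rightarrow> int \<Rightarrow> 's \<Rightarrow> int \<Rightarrow> 's \<Rightarrow> bool" where
  "cycle_all f Q P s0 i s =
     (if i < P then (if Q i s then cycle_all f Q P s0 (i + 1) (f s) else False) else s = s0)"
  by auto
termination by (relation "measure (\<lambda>(f, Q, P, s0, i, s). nat (P - i))") auto

declare cycle_all.simps [simp del]

lemma cycle_all_run:
  assumes "cycle_all f Q P s0 i s" "i \<le> P"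
  shows "(\<forall>j. i + int j < P \<longrightarrow> Q (i + int j) ((f ^^ j) s)) \<and> (f ^^ nat (P - i)) s = s0"
  using assms
proof (induction f Q P s0 i s rule: cycle_all.induct)
  case (1 f Q P s0 i s)
  show ?case
  proof (cases "i < P")
    case True
    with "1.prems" have Q: "Q i s" and rest: "cycle_all f Q P s0 (i + 1) (f s)"
      by (simp_all add: cycle_all.simps [of f Q P s0 i s] split: if_splits)
    note IH = "1.IH" [OF True Q rest]
    have "Q (i + int j) ((f ^^ j) s)" if "i + int j < P" for j
    proof (cases j)
      case 0
      with Q show ?thesis by simp
    next
      case (Suc j')
      with IH True that show ?thesis by (auto simp: funpow_swap1 algebra_simps)
    qed
    moreover have "nat (P - i) = Suc (nat (P - (i + 1)))"
      using True by simp
    ultimately show ?thesis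
      using IH True by (simp add: funpow_swap1)
  next
    case False
    with "1.prems" show ?thesis by (simp add: cycle_all.simps [of f Q P s0 i s])
  qed
qed

text \<open>A run that returns to its start makes the orbit periodic, so one finite check of
  \<open>Q\<close> covers every \<open>n\<close>.\<close>

lemma cycle_all_mod:
  assumes "cycle_all f Q P s 0 s" "0 < P"
  shows "Q (int n mod P) ((f ^^ n) s)"
proof -
  note run = cycle_all_run [OF assms(1)]
  have "(f ^^ (n mod nat P)) s = (f ^^ n) s"
    using run assms(2) by (intro funpow_mod_eq) simp
  moreover have "int (n mod nat P) = int n mod P"
    using assms(2) by (simp add: zmod_int)
  ultimately show ?thesis
    using run assms(2) by (metis add_0 less_imp_le pos_mod_bound)
qed

section \<open>Fibonacci numbers and repunits modulo M\<close>

fun fib_step :: "int \<Rightarrow> int \<times> int \<Rightarrow> int \<times> int" where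
  "fib_step M (a, b) = (b, let s = a + b in if s < M then s else s - M)"

text \<open>The sum of two reduced residues is below \<open>2 * M\<close>, so one subtraction
  reduces it.\<close>

lemma fib_step_eq:
  assumes "a \<in> {0..<M}" "b \<in> {0..<M}"
  shows "fib_step M (a, b) = (b, (a + b) mod M)"
proof -
  have "(a + b) mod M = (if a + b < M then a + b else a + b - M)"
    using assms mod_pos_pos_trivial [of "a + b" M] mod_pos_pos_trivial [of "a + b - M" M]
    by auto
  then show ?thesis by (simp add: Let_def)
qed

lemma funpow_fib_step:
  assumes "0 \<le> c" "c < M"
  shows "(fib_step M ^^ n) (0, c) = (c * int (fib n) mod M, c * int (fib (Suc n)) mod M)"
proof (induction n)
  case 0
  with assms show ?case by simp
next
  case (Suc n)
  have M: "0 < M" using assms by linarith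
  have "(fib_step M ^^ Suc n) (0, c)
      = fib_step M (c * int (fib n) mod M, c * int (fib (Suc n)) mod M)"
    by (simp only: funpow.simps o_apply Suc)
  also have "\<dots> = (c * int (fib (Suc n)) mod M,
      (c * int (fib n) mod M + c * int (fib (Suc n)) mod M) mod M)"
    by (rule fib_step_eq) (simp_all only: atLeastLessThan_iff pos_mod_sign [OF M] pos_mod_bound [OF M] simp_thms)
  also have "(c * int (fib n) mod M + c * int (fib (Suc n)) mod M) mod M
      = (c * int (fib n) + c * int (fib (Suc n))) mod M"
    by (rule mod_add_eq)
  also have "c * int (fib n) + c * int (fib (Suc n)) = c * int (fib (Suc (Suc n)))"
    by (simp add: distrib_left)
  finally show ?case .
qed

lemma fib_cycle:
  assumes "cycle_all (fib_step M) Q P (0, c) 0 (0, c)" "0 < P" "0 \<le> c" "c < M"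
  shows "Q (int n mod P) (c * int (fib n) mod M, c * int (fib (Suc n)) mod M)"
  using cycle_all_mod [OF assms(1,2), of n] by (simp only: funpow_fib_step [OF assms(3,4)])

text \<open>Appending a digit 1 makes the residues of R_n an orbit of \<open>10 * x + 1\<close>,
  free of division.\<close>

primrec repunit :: "nat \<Rightarrow> int" where
  "repunit 0 = 0"
| "repunit (Suc n) = 10 * repunit n + 1"

lemma repunit_eq_power: "9 * repunit n + 1 = 10 ^ n"
  by (induction n) auto

lemma funpow_repunit: "0 < M \<Longrightarrow> ((\<lambda>x. (10 * x + 1) mod M) ^^ n) 0 = repunit n mod M"
proof (induction n)
  case (Suc n)
  have "(10 * (repunit n mod M) + 1) mod M = (10 * repunit n + 1) mod M"
    by (metis mod_add_left_eq mod_mult_right_eq)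
  with Suc show ?case by simp
qed simp

lemma repunit_cycle:
  assumes "cycle_all (\<lambda>x. (10 * x + 1) mod M) Q P 0 0 0" "0 < P" "0 < M"
  shows "Q (int n mod P) (repunit n mod M)"
  using cycle_all_mod [OF assms(1,2), of n] assms(3) by (simp add: funpow_repunit)

section \<open>Ranks of apparition and orders of 10\<close>

text \<open>\<open>P\<close> is a period modulo \<open>p\<close> and \<open>z\<close> divides the
  rank of apparition; as \<open>z dvd P\<close>, the index modulo \<open>P\<close> decides.\<close>

lemma fib_dvd_cycle:
  assumes "cycle_all (fib_step p) (\<lambda>i s. fst s = 0 \<longrightarrow> i mod z = 0) P (0, 1) 0 (0, 1)"
    and "z dvd P" "0 < P" "1 < p" "p dvd int (fib n)"
  shows "z dvd int n"
proof -
  have "1 * int (fib n) mod p = 0 \<longrightarrow> int n mod P mod z = 0"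
    using fib_cycle [OF assms(1,3) _ assms(4), of n] by simp
  moreover have "1 * int (fib n) mod p = 0"
    using assms(5) by (metis mod_eq_0_iff_dvd mult_1)
  ultimately show ?thesis
    using mod_mod_cancel [OF assms(2), of "int n"] by (metis mod_eq_0_iff_dvd)
qed

lemma dvd_fib_cycle:
  assumes "cycle_all (fib_step p) (\<lambda>i s. i mod z = 0 \<longrightarrow> fst s = 0) P (0, 1) 0 (0, 1)"
    and "z dvd P" "0 < P" "1 < p" "z dvd int n"
  shows "p dvd int (fib n)"
proof -
  have "int n mod P mod z = 0 \<longrightarrow> 1 * int (fib n) mod p = 0"
    using fib_cycle [OF assms(1,3) _ assms(4), of n] by simp
  moreover have "int n mod P mod z = 0"
    using assms(5) mod_mod_cancel [OF assms(2), of "int n"] by (metis mod_eq_0_iff_dvd)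
  ultimately show ?thesis
    by (metis mod_eq_0_iff_dvd mult_1)
qed

lemma repunit_dvd_cycle:
  assumes "cycle_all (\<lambda>x. (10 * x + 1) mod p) (\<lambda>i x. x = 0 \<longrightarrow> i mod z = 0) P 0 0 0"
    and "z dvd P" "0 < P" "0 < p" "p dvd repunit n"
  shows "z dvd int n"
proof -
  have "repunit n mod p = 0 \<longrightarrow> int n mod P mod z = 0"
    by (rule repunit_cycle [OF assms(1,3,4)])
  with assms(5) show ?thesis
    using mod_mod_cancel [OF assms(2), of "int n"] by (metis mod_eq_0_iff_dvd)
qed

lemma dvd_repunit_cycle:
  assumes "cycle_all (\<lambda>x. (10 * x + 1) mod p) (\<lambda>i x. i mod z = 0 \<longrightarrow> x = 0) P 0 0 0"
    and "z dvd P" "0 < P" "0 < p" "z dvd int n"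
  shows "p dvd repunit n"
proof -
  have "int n mod P mod z = 0 \<longrightarrow> repunit n mod p = 0"
    by (rule repunit_cycle [OF assms(1,3,4)])
  with assms(5) show ?thesis
    using mod_mod_cancel [OF assms(2), of "int n"] by (metis mod_eq_0_iff_dvd)
qed

lemma dvd_fib_41: "41 dvd int (fib n) \<Longrightarrow> 20 dvd int n"
  by (erule fib_dvd_cycle [where P = 40, rotated -1]) (code_simp | simp)+

lemma dvd_fib_101: "101 dvd int (fib n) \<Longrightarrow> 50 dvd int n"
  by (erule fib_dvd_cycle [where P = 50, rotated -1]) (code_simp | simp)+

lemma dvd_fib_271: "271 dvd int (fib n) \<Longrightarrow> 3 dvd int n"
  by (erule fib_dvd_cycle [where P = 270, rotated -1]) (code_simp | simp)+

text \<open>F_15 = 610 = 10 * 61 divides F_n; likewise 41 divides F_20 = 6765, and 151 divides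
  F_50.\<close>

lemma fib_multiple_15: "15 dvd int n \<Longrightarrow> 61 dvd int (fib n)"
  by (erule dvd_fib_cycle [where P = 60, rotated -1]) (code_simp | simp)+

lemma fib_multiple_20: "20 dvd int n \<Longrightarrow> 41 dvd int (fib n)"
  by (erule dvd_fib_cycle [where P = 40, rotated -1]) (code_simp | simp)+

lemma fib_multiple_50: "50 dvd int n \<Longrightarrow> 151 dvd int (fib n)"
  by (erule dvd_fib_cycle [where P = 50, rotated -1]) (code_simp | simp)+

text \<open>16 divides F_12 = 144, 25 divides F_25 = 75025, and lcm(12, 25) = 300. The period modulo
  400 is 600.\<close>

lemma fib_multiple_300: "300 dvd int n \<Longrightarrow> 400 dvd int (fib n)"
  by (erule dvd_fib_cycle [where P = 600, rotated -1]) (code_simp | simp)+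

text \<open>10 has order 60 modulo 61, 75 modulo 151 and 5 modulo 41; the factors 4 and 5 of these
  orders are extracted.\<close>

lemma dvd_repunit_61: "61 dvd repunit n \<Longrightarrow> 4 dvd int n"
  by (erule repunit_dvd_cycle [where P = 60, rotated -1]) (code_simp | simp)+

lemma dvd_repunit_151: "151 dvd repunit n \<Longrightarrow> 5 dvd int n"
  by (erule repunit_dvd_cycle [where P = 75, rotated -1]) (code_simp | simp)+

lemma dvd_repunit_41: "41 dvd repunit n \<Longrightarrow> 5 dvd int n"
  by (erule repunit_dvd_cycle [where P = 5, rotated -1]) (code_simp | simp)+

text \<open>R_4 = 11 * 101 divides R_n; the next two lemmas use R_5 = 41 * 271.\<close>

lemma repunit_multiple_4_101: "4 dvd int n \<Longrightarrow> 101 dvd repunit n"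
  by (erule dvd_repunit_cycle [where P = 4, rotated -1]) (code_simp | simp)+

lemma repunit_multiple_5_41: "5 dvd int n \<Longrightarrow> 41 dvd repunit n"
  by (erule dvd_repunit_cycle [where P = 5, rotated -1]) (code_simp | simp)+

lemma repunit_multiple_5_271: "5 dvd int n \<Longrightarrow> 271 dvd repunit n"
  by (erule dvd_repunit_cycle [where P = 5, rotated -1]) (code_simp | simp)+

section \<open>The factor 400\<close>

text \<open>R_e ends in the digit 1, hence is prime to 10 and to 10^4 = 25 * 400.\<close>

lemma coprime_repunit:
  assumes "1 \<le> e"
  shows "coprime 400 (repunit e)"
proof -
  obtain e' where e: "e = Suc e'"
    using assms by (cases e) auto
  have "gcd 10 (10 * repunit e' + 1) = gcd 10 (1 :: int)"
    by (metis gcd_add_mult add.commute mult.commute)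
  then have "coprime 10 (repunit e)"
    by (simp add: e coprime_iff_gcd_eq_1)
  then have "coprime (10 ^ 4) (repunit e)"
    by (simp only: coprime_power_left_iff simp_thms)
  then show ?thesis
    by (rule coprime_divisors [rotated 2]) auto
qed

text \<open>The factor 25 takes two digits 5, and no third digit supplies 16.\<close>

lemma digit_product_not_multiple_400:
  assumes "a \<in> {1..9}" "b \<in> {1..9}" "c \<in> {1..9}"
  shows "\<not> 400 dvd a * b * (c :: int)"
proof -
  have "list_all (\<lambda>a. list_all (\<lambda>b. list_all (\<lambda>c. a * b * c mod 400 \<noteq> 0) [1..9]) [1..9]) [1..9 :: int]"
    by code_simp
  with assms show ?thesis
    by (simp only: list_all_iff set_upto dvd_eq_mod_eq_0) blast
qed

section \<open>The sieve modulo 101000\<close>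

text \<open>
  Here \<open>i\<close> is the index modulo 1500 and \<open>x\<close> the candidate for the product of digits,
  which divides \<open>2520 ^ 3\<close> because every digit divides 2520; this also excludes \<open>x = 0\<close>.
\<close>

fun sieve_test :: "int \<Rightarrow> int \<Rightarrow> int \<Rightarrow> int \<Rightarrow> int \<Rightarrow> int \<times> int \<Rightarrow> bool" where
  "sieve_test a b c w i (x, y) =
     (if 729 < x then True
      else if i mod 20 = 0 \<or> i mod 15 = 0 \<or> i mod 50 = 0 then True
      else if (w * x) mod 11 \<noteq> [0, 1, 1, 2, 3, 5, 8, 2, 10, 1] ! nat (i mod 10) then True
      else if 2520 ^ 3 mod x \<noteq> 0 then True
      else (a, b, c, i, x) \<in> set
        [(1,1,1,1,1), (1,1,1,2,1), (1,1,1,3,2), (1,1,1,4,3), (1,1,1,5,5), (1,1,1,6,8),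
         (1,1,1,8,21), (1,1,1,12,144), (1,1,1,1495,5), (1,1,1,1497,2), (1,1,1,1499,1),
         (1,1,2,10,5), (1,2,5,110,5), (1,5,5,605,5), (1,5,5,895,5), (2,5,5,1210,5)])"

text \<open>
  The class of an exponent is the exponent itself up to 2, and otherwise its representative modulo 4
  in \<open>{3..6}\<close>; class 4 does not occur.
\<close>

definition class_value :: "int \<Rightarrow> int" where
  "class_value c = (if c = 1 then 1 else if c = 2 then 11 else if c = 3 then 111
     else if c = 5 then 11111 else 111111)"

text \<open>Inverses of \<open>class_value\<close> modulo 101000. They exist because R_1, R_2, R_3,
  R_5, R_6 are prime to 10 and 101, unlike R_4 = 11 * 101.\<close>

definition class_inverse :: "int \<Rightarrow> int" where
  "class_inverse c = (if c = 1 then 1 else if c = 2 then 55091 else if c = 3 then 90991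
     else if c = 5 then 99991 else 44991)"

text \<open>
  Multiplying the Fibonacci sequence by the inverse \<open>v\<close> of \<open>w\<close> gives a sequence with the same
  recurrence, so a single additive cycle runs through all candidates.
\<close>

fun sieve :: "int \<times> int \<times> int \<Rightarrow> bool" where
  "sieve (a, b, c) =
    (let w = class_value a * class_value b * class_value c;
         v = class_inverse a * class_inverse b * class_inverse c mod 101000
     in w * v mod 101000 = 1 \<and>
        cycle_all (fib_step 101000) (sieve_test a b c w) 1500 (0, v) 0 (0, v))"

text \<open>The 35 sorted triples are split by their smallest class: 1, then 2, then at least
  3.\<close>

lemma sieve_1: "list_all sieve
    [(1,1,1), (1,1,2), (1,1,3), (1,1,5), (1,1,6), (1,2,2), (1,2,3), (1,2,5), (1,2,6),
     (1,3,3), (1,3,5), (1,3,6), (1,5,5), (1,5,6), (1,6,6)]"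
  by code_simp

lemma sieve_2: "list_all sieve
    [(2,2,2), (2,2,3), (2,2,5), (2,2,6), (2,3,3), (2,3,5), (2,3,6), (2,5,5), (2,5,6), (2,6,6)]"
  by code_simp

lemma sieve_3: "list_all sieve
    [(3,3,3), (3,3,5), (3,3,6), (3,5,5), (3,5,6), (3,6,6), (5,5,5), (5,5,6), (5,6,6), (6,6,6)]"
  by code_simp

lemma sieve_sorted:
  assumes "{a, b, c} \<subseteq> {1, 2, 3, 5, 6}" "a \<le> b" "b \<le> c"
  shows "sieve (a, b, c)"
  using assms sieve_1 sieve_2 sieve_3
  by (auto simp del: sieve.simps)

section \<open>Repunit classes and Fibonacci residues modulo 11\<close>

definition repunit_class :: "nat \<Rightarrow> int" where
  "repunit_class e = (if e \<le> 2 then int e else 3 + (int e - 3) mod 4)"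

text \<open>The difference is R_4 * 10^(e+3); the shift by 3 supplies the factor 1000.\<close>

lemma repunit_add_4: "[repunit (e + 7) = repunit (e + 3)] (mod 1111000)"
proof -
  have "repunit (e + 7) - repunit (e + 3) = 1111000 * 10 ^ e"
    using repunit_eq_power [of e] by (simp add: eval_nat_numeral)
  then show ?thesis
    by (simp add: cong_iff_dvd_diff)
qed

lemma repunit_cong_mod_4:
  "[repunit (r + 4 * q + 3) = repunit (r + 3)] (mod 1111000)"
proof (induction q)
  case (Suc q)
  have "[repunit (r + 4 * q + 7) = repunit (r + 4 * q + 3)] (mod 1111000)"
    by (rule repunit_add_4)
  moreover have "r + 4 * Suc q + 3 = r + 4 * q + 7"
    by simp
  ultimately show ?case
    using Suc by (simp only:) (rule cong_trans)
qed simp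

lemma repunit_class:
  assumes "1 \<le> e" "\<not> 4 dvd int e"
  shows "repunit_class e \<in> {1, 2, 3, 5, 6}"
    and "[repunit e = class_value (repunit_class e)] (mod 1111000)"
proof -
  have "repunit_class e \<in> {1, 2, 3, 5, 6} \<and> [repunit e = class_value (repunit_class e)] (mod 1111000)"
  proof (cases "e \<le> 2")
    case True
    with assms have "e = 1 \<or> e = 2" by auto
    then show ?thesis
      by (auto simp: repunit_class_def class_value_def numeral_2_eq_2)
  next
    case False
    define r q where "r = (e - 3) mod 4" and "q = (e - 3) div 4"
    have e: "e = r + 4 * q + 3"
      using False by (simp add: r_def q_def)
    have "r < 4" by (simp add: r_def)
    \<comment> \<open>\<open>r = 1\<close> would give \<open>e = 4 * q + 4\<close>, a multiple of
      4.\<close>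
    moreover have "r \<noteq> 1"
      using assms(2) unfolding e by auto
    ultimately have r: "r = 0 \<or> r = 2 \<or> r = 3" by auto
    have "repunit_class e = 3 + int r"
      using False \<open>r < 4\<close> by (simp add: repunit_class_def e)
    moreover have "[repunit e = repunit (r + 3)] (mod 1111000)"
      unfolding e by (rule repunit_cong_mod_4)
    ultimately show ?thesis
      using r by (auto simp: class_value_def eval_nat_numeral)
  qed
  then show "repunit_class e \<in> {1, 2, 3, 5, 6}"
    and "[repunit e = class_value (repunit_class e)] (mod 1111000)"
    by auto
qed

lemma repunit_class_exact: "1 \<le> e \<Longrightarrow> repunit_class e = 1 \<Longrightarrow> e = 1"
  "1 \<le> e \<Longrightarrow> repunit_class e = 2 \<Longrightarrow> e = 2"
  by (simp_all add: repunit_class_def split: if_splits)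

text \<open>Class 5 means that e is 1 modulo 4; oddness gives access to the table modulo
  10291.\<close>

lemma repunit_class_5_odd: "repunit_class e = 5 \<Longrightarrow> int e mod 2 = 1"
  by (simp add: repunit_class_def split: if_splits) presburger

lemma fib_mod_11: "int (fib n) mod 11 = [0, 1, 1, 2, 3, 5, 8, 2, 10, 1] ! nat (int n mod 10)"
proof -
  have "cycle_all (fib_step 11) (\<lambda>i s. fst s = [0, 1, 1, 2, 3, 5, 8, 2, 10, 1] ! nat i) 10 (0, 1) 0 (0, 1)"
    by code_simp
  from fib_cycle [OF this, of n] show ?thesis by simp
qed

section \<open>The remaining families modulo 10291\<close>

text \<open>The residues of R_e for e prime to 10. The order of 10 is 5 modulo 41 and 50 modulo 251,
  so e counts modulo 50, which leaves 20 classes.\<close>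

definition residues_10291 :: "int list" where
  "residues_10291 =
    [1, 111, 216, 585, 603, 739, 1029, 1200, 1805, 1874,
     4104, 5564, 5823, 6015, 6810, 7056, 7965, 9062, 9475, 9974]"

lemma repunit_mod_10291:
  assumes "int e mod 2 = 1" "\<not> 5 dvd int e"
  shows "repunit e mod 10291 \<in> set residues_10291"
proof -
  have "cycle_all (\<lambda>x. (10 * x + 1) mod 10291)
      (\<lambda>i x. i mod 2 = 0 \<or> i mod 5 = 0 \<or> x \<in> set residues_10291) 50 0 0 0"
    by code_simp
  from repunit_cycle [OF this, of e]
  have "int e mod 50 mod 2 = 0 \<or> int e mod 50 mod 5 = 0 \<or> repunit e mod 10291 \<in> set residues_10291"
    by simp
  moreover have "int e mod 50 mod 2 \<noteq> 0" "int e mod 50 mod 5 \<noteq> 0"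
    using assms by presburger+
  ultimately show ?thesis by blast
qed

text \<open>The period is 1000, and k mod 1500 fixes k only modulo gcd(1000, 1500) = 500; the two
  lifts give two values. 605 and 895 are opposite modulo 1500 and share theirs, as F_(-j) = F_j for
  odd j.\<close>

lemma fib_mod_10291:
  shows "int n mod 1500 \<in> {605, 895} \<Longrightarrow> int (fib n) mod 10291 \<in> {7416, 7918}"
    and "int n mod 1500 = 1210 \<Longrightarrow> int (fib n) mod 10291 \<in> {2310, 7079}"
    and "int n mod 1500 = 110 \<Longrightarrow> int (fib n) mod 10291 \<in> {1654, 6423}"
proof -
  have "cycle_all (fib_step 10291)
      (\<lambda>i s. (i mod 500 \<noteq> 105 \<and> i mod 500 \<noteq> 395 \<or> fst s \<in> {7416, 7918}) \<and>
        (i mod 500 \<noteq> 210 \<or> fst s \<in> {2310, 7079}) \<and> (i mod 500 \<noteq> 110 \<or> fst s \<in> {1654, 6423}))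
      1000 (0, 1) 0 (0, 1)"
    by code_simp
  from fib_cycle [OF this, of n]
  have *: "int n mod 1500 mod 500 = 105 \<or> int n mod 1500 mod 500 = 395 \<Longrightarrow> int (fib n) mod 10291 \<in> {7416, 7918}"
    "int n mod 1500 mod 500 = 210 \<Longrightarrow> int (fib n) mod 10291 \<in> {2310, 7079}"
    "int n mod 1500 mod 500 = 110 \<Longrightarrow> int (fib n) mod 10291 \<in> {1654, 6423}"
    by (auto simp: mod_mod_cancel [of 500 1000 "int n"] mod_mod_cancel [of 500 1500 "int n"])
  show "int n mod 1500 \<in> {605, 895} \<Longrightarrow> int (fib n) mod 10291 \<in> {7416, 7918}"
    by (rule *(1)) auto
  show "int n mod 1500 = 1210 \<Longrightarrow> int (fib n) mod 10291 \<in> {2310, 7079}"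
    by (rule *(2)) simp
  show "int n mod 1500 = 110 \<Longrightarrow> int (fib n) mod 10291 \<in> {1654, 6423}"
    by (rule *(3)) simp
qed

text \<open>The factors are the digit product 5 and 55 = 5 * R_2; the excluded values are those of
  F_k in the matching family.\<close>

lemma residue_products_10291:
  assumes "x mod 10291 \<in> set residues_10291" "y mod 10291 \<in> set residues_10291"
  shows "5 * (x * y) mod 10291 \<notin> {7416, 7918}" "55 * (x * y) mod 10291 \<notin> {2310, 7079}" "55 * x mod 10291 \<notin> {1654, 6423}"
proof -
  have 1: "list_all (\<lambda>x. list_all (\<lambda>y. 5 * (x * y) mod 10291 \<notin> {7416, 7918} \<and> 55 * (x * y) mod 10291 \<notin> {2310, 7079})
      residues_10291) residues_10291"
    by code_simp
  have 2: "list_all (\<lambda>x. 55 * x mod 10291 \<notin> {1654, 6423}) residues_10291"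
    by code_simp
  have "a * (x * y) mod 10291 = a * ((x mod 10291) * (y mod 10291)) mod 10291" for a
    by (metis mod_mult_eq mod_mult_right_eq)
  with 1 assms show "5 * (x * y) mod 10291 \<notin> {7416, 7918}" "55 * (x * y) mod 10291 \<notin> {2310, 7079}"
    unfolding list_all_iff by metis+
  have "55 * x mod 10291 = 55 * (x mod 10291) mod 10291"
    by (simp only: mod_mult_right_eq)
  with 2 assms show "55 * x mod 10291 \<notin> {1654, 6423}"
    unfolding list_all_iff by metis
qed

section \<open>Divisibility constraints and the case analysis\<close>

text \<open>The exponents are left unordered so that the factors can be arranged by class instead of
  by size.\<close>

locale fib_triple_product =
  fixes k l m n :: nat and d1 d2 d3 :: int
  assumes digits: "d1 \<in> {1..9}" "d2 \<in> {1..9}" "d3 \<in> {1..9}"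
    and exponents: "1 \<le> l" "1 \<le> m" "1 \<le> n"
    and fib_eq: "int (fib k) = d1 * d2 * d3 * (repunit l * repunit m * repunit n)"
begin

lemma repunit_dvd_fib: "e \<in> {l, m, n} \<Longrightarrow> p dvd repunit e \<Longrightarrow> p dvd int (fib k)"
  unfolding fib_eq by auto

lemma prime_dvd_fib:
  assumes "prime p" "9 < p" "p dvd int (fib k)"
  obtains e where "e \<in> {l, m, n}" "p dvd repunit e"
proof -
  have "\<not> p dvd d1" "\<not> p dvd d2" "\<not> p dvd d3"
    using digits assms(2) zdvd_imp_le [of p] by fastforce+
  then show thesis
    using that assms(1,3) unfolding fib_eq by (auto simp: prime_dvd_mult_iff)
qed

lemma not_400_dvd: "\<not> 400 dvd int (fib k)"
proof
  assume "400 dvd int (fib k)"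
  moreover have "coprime 400 (repunit l * repunit m * repunit n)"
    using exponents by (simp add: coprime_repunit)
  ultimately have "400 dvd d1 * d2 * d3"
    unfolding fib_eq by (simp add: coprime_dvd_mult_left_iff)
  with digit_product_not_multiple_400 [OF digits] show False ..
qed

text \<open>R_5 = 41 * 271 divides R_e and hence F_k; the ranks of both primes then act on
  k.\<close>

lemma index_of_5_dvd:
  assumes "e \<in> {l, m, n}" "5 dvd int e"
  shows "20 dvd int k" "3 dvd int k"
  using assms repunit_dvd_fib repunit_multiple_5_41 repunit_multiple_5_271 dvd_fib_41 dvd_fib_271
  by blast+

text \<open>50 | k gives 151 | F_k, so 5 | e for some exponent e, so 20 | k and 3 | k; then 300 | k
  forces 400 | F_k.\<close>

lemma not_50_dvd: "\<not> 50 dvd int k"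
proof
  assume k: "50 dvd int k"
  obtain e where "e \<in> {l, m, n}" "151 dvd repunit e"
    using prime_dvd_fib [of 151] fib_multiple_50 [OF k] by auto
  then have "20 dvd int k" "3 dvd int k"
    using index_of_5_dvd dvd_repunit_151 by blast+
  with k have "300 dvd int k" by presburger
  with fib_multiple_300 not_400_dvd show False by blast
qed

text \<open>4 | e would give 101 | F_k and 50 | k.\<close>

lemma exponent_not_4_dvd: "e \<in> {l, m, n} \<Longrightarrow> \<not> 4 dvd int e"
  using repunit_multiple_4_101 repunit_dvd_fib dvd_fib_101 not_50_dvd by blast

text \<open>15 | k would give 61 | F_k, hence 4 | e for some exponent e.\<close>

lemma not_15_dvd: "\<not> 15 dvd int k"
proof
  assume "15 dvd int k"
  then obtain e where "e \<in> {l, m, n}" "61 dvd repunit e"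
    using prime_dvd_fib [of 61] fib_multiple_15 by auto
  with dvd_repunit_61 exponent_not_4_dvd show False by blast
qed

lemma exponent_not_5_dvd:
  assumes "e \<in> {l, m, n}"
  shows "\<not> 5 dvd int e"
proof
  assume "5 dvd int e"
  from index_of_5_dvd [OF assms this] have "15 dvd int k" by presburger
  with not_15_dvd show False ..
qed

lemma not_20_dvd: "\<not> 20 dvd int k"
proof
  assume "20 dvd int k"
  then obtain e where "e \<in> {l, m, n}" "41 dvd repunit e"
    using prime_dvd_fib [of 41] fib_multiple_20 by auto
  with dvd_repunit_41 exponent_not_5_dvd show False by blast
qed

lemma fib_mem:
  assumes "repunit_class l \<le> repunit_class m" "repunit_class m \<le> repunit_class n"
  shows "int (fib k) \<in> {1, 2, 3, 5, 8, 21, 55, 144}"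
proof -
  define D where "D = d1 * d2 * d3"
  define W where "W = repunit l * repunit m * repunit n"
  define a b c where "a = repunit_class l" and "b = repunit_class m" and "c = repunit_class n"
  define w where "w = class_value a * class_value b * class_value c"
  define v where "v = class_inverse a * class_inverse b * class_inverse c mod 101000"
  have fib: "int (fib k) = D * W"
    by (simp add: fib_eq D_def W_def)
  note classes = repunit_class [OF exponents(1) exponent_not_4_dvd]
    repunit_class [OF exponents(2) exponent_not_4_dvd]
    repunit_class [OF exponents(3) exponent_not_4_dvd]
  have abc: "{a, b, c} \<subseteq> {1, 2, 3, 5, 6}"
    unfolding a_def b_def c_def using classes by blast
  have W: "[W = w] (mod 1111000)"
    unfolding W_def w_def a_def b_def c_def by (intro cong_mult classes) simp_all
  have "sieve (a, b, c)"
    using abc assms by (intro sieve_sorted) (simp_all add: a_def b_def c_def)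
  then have wv: "w * v mod 101000 = 1"
    and cycle: "cycle_all (fib_step 101000) (sieve_test a b c w) 1500 (0, v) 0 (0, v)"
    by (simp_all only: sieve.simps Let_def w_def v_def)
  have D_ge: "1 \<le> D"
    using digits unfolding D_def by (simp add: int_one_le_iff_zero_less)
  have "d1 * d2 * d3 \<le> 9 * 9 * 9"
    using digits by (intro mult_mono) auto
  then have D_le: "D \<le> 729"
    by (simp add: D_def)
  have dvd_2520: "d dvd 2520" if "d \<in> {1..9}" for d :: int
  proof -
    have "d \<in> {1, 2, 3, 4, 5, 6, 7, 8, 9}" using that by auto
    then show ?thesis by auto
  qed
  have "D dvd 2520 * 2520 * 2520"
    unfolding D_def using digits by (intro mult_dvd_mono dvd_2520)
  then have D_dvd: "2520 ^ 3 mod D = 0"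
    by (simp add: eval_nat_numeral dvd_eq_mod_eq_0)
  \<comment> \<open>Multiplying by the inverse \<open>v\<close> of \<open>w\<close> isolates
    \<open>D\<close>; as \<open>D\<close> is at most 729, its residue is \<open>D\<close>
    itself.\<close>
  have "[v * int (fib k) = D * (w * v)] (mod 101000)"
  proof -
    have "[W = w] (mod 101000)"
      using W by (rule cong_dvd_modulus) simp
    then have "[v * D * W = v * D * w] (mod 101000)"
      by (rule cong_scalar_left)
    then show ?thesis by (simp add: fib ac_simps)
  qed
  also have "[D * (w * v) = D * 1] (mod 101000)"
    by (rule cong_scalar_left) (simp add: cong_def wv)
  finally have x: "v * int (fib k) mod 101000 = D"
    using D_ge D_le by (simp add: cong_def)
  have period: "int k mod 1500 mod 10 = int k mod 10"
    by (rule mod_mod_cancel) simp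
  \<comment> \<open>11 divides R_2 and R_6, so \<open>w\<close> need not be invertible here; the
    products are compared instead.\<close>
  have "[W = w] (mod 11)"
    using W by (rule cong_dvd_modulus) simp
  then have "[D * W = D * w] (mod 11)"
    by (rule cong_scalar_left)
  then have "(w * D) mod 11 = int (fib k) mod 11"
    by (simp add: fib cong_def mult.commute)
  also have "\<dots> = [0, 1, 1, 2, 3, 5, 8, 2, 10, 1] ! nat (int k mod 1500 mod 10)"
    by (simp only: fib_mod_11 period)
  finally have mod_11: "(w * D) mod 11 = [0, 1, 1, 2, 3, 5, 8, 2, 10, 1] ! nat (int k mod 1500 mod 10)" .
  define i where "i = int k mod 1500"
  have "i mod z = int k mod z" if "z dvd 1500" for z
    unfolding i_def by (rule mod_mod_cancel [OF that])
  then have "i mod 20 = int k mod 20" "i mod 15 = int k mod 15" "i mod 50 = int k mod 50"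
    by simp_all
  then have i: "i mod 20 \<noteq> 0" "i mod 15 \<noteq> 0" "i mod 50 \<noteq> 0"
    using not_20_dvd not_15_dvd not_50_dvd by (simp_all only: dvd_eq_mod_eq_0 not_False_eq_True)
  have "sieve_test a b c w i (v * int (fib k) mod 101000, v * int (fib (Suc k)) mod 101000)"
    unfolding i_def by (rule fib_cycle [OF cycle]) (simp_all add: v_def)
  then have mem: "(a, b, c, i, D) \<in> set
        [(1,1,1,1,1), (1,1,1,2,1), (1,1,1,3,2), (1,1,1,4,3), (1,1,1,5,5), (1,1,1,6,8),
         (1,1,1,8,21), (1,1,1,12,144), (1,1,1,1495,5), (1,1,1,1497,2), (1,1,1,1499,1),
         (1,1,2,10,5), (1,2,5,110,5), (1,5,5,605,5), (1,5,5,895,5), (2,5,5,1210,5)]"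
    using D_le D_dvd i mod_11 [folded i_def]
    by (simp only: x sieve_test.simps not_less [symmetric] if_True if_False simp_thms)
  note exact = repunit_class_exact [OF exponents(1), folded a_def]
    repunit_class_exact [OF exponents(2), folded b_def]
    repunit_class_exact [OF exponents(3), folded c_def]
  have odd_residue: "repunit e mod 10291 \<in> set residues_10291"
    if "e \<in> {l, m, n}" "repunit_class e = 5" for e
    using repunit_mod_10291 repunit_class_5_odd exponent_not_5_dvd that by blast
  \<comment> \<open>Indices 1495, 1497, 1499 stand for -5, -3, -1. They fall under
    \<open>small\<close>, where F_k = \<open>D\<close> is already a listed value.\<close>
  from mem consider
      (small) "a = 1" "b = 1" "c = 1" "D \<in> {1, 2, 3, 5, 8, 21, 144}"
    | (eleven) "a = 1" "b = 1" "c = 2" "D = 5"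
    | (r1) "a = 1" "b = 2" "c = 5" "i = 110" "D = 5"
    | (r2) "a = 1" "b = 5" "c = 5" "i \<in> {605, 895}" "D = 5"
    | (r3) "a = 2" "b = 5" "c = 5" "i = 1210" "D = 5"
    by auto
  then show ?thesis
  proof cases
    case small
    then have "l = 1" "m = 1" "n = 1" using exact by auto
    with small show ?thesis by (auto simp: fib W_def)
  next
    case eleven
    then have "l = 1" "m = 1" "n = 2" using exact by auto
    with eleven show ?thesis by (simp add: fib W_def numeral_2_eq_2)
  next
    case r1
    then have "l = 1" "m = 2" using exact by auto
    then have "int (fib k) = 55 * repunit n"
      using r1 by (simp add: fib W_def numeral_2_eq_2)
    moreover have "repunit n mod 10291 \<in> set residues_10291"
      using odd_residue r1 c_def by simp
    ultimately show ?thesis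
      using residue_products_10291(3) fib_mod_10291(3) [of k] r1 unfolding i_def by metis
  next
    case r2
    then have "l = 1" using exact by auto
    then have "int (fib k) = 5 * (repunit m * repunit n)"
      using r2 by (simp add: fib W_def)
    moreover have "repunit m mod 10291 \<in> set residues_10291" "repunit n mod 10291 \<in> set residues_10291"
      using odd_residue r2 b_def c_def by simp_all
    ultimately show ?thesis
      using residue_products_10291(1) fib_mod_10291(1) [of k] r2 unfolding i_def by metis
  next
    case r3
    then have "l = 2" using exact by auto
    then have "int (fib k) = 55 * (repunit m * repunit n)"
      using r3 by (simp add: fib W_def numeral_2_eq_2)
    moreover have "repunit m mod 10291 \<in> set residues_10291" "repunit n mod 10291 \<in> set residues_10291"
      using odd_residue r3 b_def c_def by simp_all
    ultimately show ?thesis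
      using residue_products_10291(2) fib_mod_10291(2) [of k] r3 unfolding i_def by metis
  qed
qed

end

section \<open>Transfer to natural numbers and the equivalence\<close>

lemma int_repdigit: "int (repdigit d m) = int d * repunit m"
proof -
  have "(10 :: int) ^ m - 1 = 9 * repunit m"
    using repunit_eq_power [of m] by simp
  moreover have "int ((10 ^ m - 1) div 9) = (10 ^ m - 1) div 9"
    by (simp add: zdiv_int of_nat_diff)
  ultimately show ?thesis
    by (simp add: repdigit_def)
qed

lemma fib_repdigits_mem:
  assumes "d1 \<in> {1..9}" "d2 \<in> {1..9}" "d3 \<in> {1..9}" "1 \<le> l" "1 \<le> m" "1 \<le> n"
    and "fib k = repdigit d1 l * repdigit d2 m * repdigit d3 n"
  shows "int (fib k) \<in> {1, 2, 3, 5, 8, 21, 55, 144}"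
proof -
  \<comment> \<open>Only the product of the digits and that of the repunits matter, so the exponents
    can be permuted while the digits stay in place.\<close>
  have product: "fib_triple_product k e1 e2 e3 (int d1) (int d2) (int d3)"
    if "mset [e1, e2, e3] = mset [l, m, n]" for e1 e2 e3
  proof
    have "set [e1, e2, e3] = set [l, m, n]"
      using that by (metis set_mset_mset)
    then show "1 \<le> e1" "1 \<le> e2" "1 \<le> e3"
      using assms(4-6) by (auto simp: set_eq_iff)
    have "prod_mset (image_mset repunit (mset [e1, e2, e3])) = prod_mset (image_mset repunit (mset [l, m, n]))"
      by (simp only: that)
    then have "repunit e1 * repunit e2 * repunit e3 = repunit l * repunit m * repunit n"
      by (simp add: ac_simps)
    then show "int (fib k) = int d1 * int d2 * int d3 * (repunit e1 * repunit e2 * repunit e3)"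
      by (simp add: assms(7) int_repdigit)
  qed (use assms(1-3) in auto)
  define es where "es = sort_key repunit_class [l, m, n]"
  have "length es = 3" "sorted (map repunit_class es)" "mset es = mset [l, m, n]"
    by (simp_all add: es_def)
  then obtain e1 e2 e3 where es: "es = [e1, e2, e3]"
    by (auto simp: length_Suc_conv eval_nat_numeral)
  show ?thesis
    using fib_triple_product.fib_mem [OF product] \<open>sorted _\<close> \<open>mset es = _\<close> by (simp add: es)
qed

theorem theorem3p3:
  fixes k :: nat
  assumes "k \<ge> 1"
  shows "(\<exists>d1 d2 d3 l m n::nat. 1 \<le> d1 \<and> d1 \<le> 9 \<and> 1 \<le> d2 \<and> d2 \<le> 9 \<and>
            1 \<le> d3 \<and> d3 \<le> 9 \<and> 1 \<le> l \<and> l \<le> m \<and> m \<le> n \<and>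
            fib k = repdigit d1 l * repdigit d2 m * repdigit d3 n)
         \<longleftrightarrow> fib k \<in> {1, 2, 3, 5, 8, 21, 55, 144}"
    (is "?product \<longleftrightarrow> _")
proof
  assume ?product
  then obtain d1 d2 d3 l m n where d: "1 \<le> d1" "d1 \<le> 9" "1 \<le> d2" "d2 \<le> 9" "1 \<le> d3" "d3 \<le> 9"
    and lmn: "1 \<le> l" "l \<le> m" "m \<le> n"
    and eq: "fib k = repdigit d1 l * repdigit d2 m * repdigit d3 n"
    by blast
  have "int (fib k) \<in> {1, 2, 3, 5, 8, 21, 55, 144}"
    by (rule fib_repdigits_mem [OF _ _ _ _ _ _ eq]) (use d lmn in simp_all)
  then show "fib k \<in> {1, 2, 3, 5, 8, 21, 55, 144}" by auto
next
  assume k: "fib k \<in> {1, 2, 3, 5, 8, 21, 55, 144}"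
  \<comment> \<open>Every listed value has a representation with l = m = 1; \<open>r\<close> is R_n,
    and n = 2 serves 55 = 5 * 11.\<close>
  have product: ?product
    if "fib k = d1 * d2 * d3 * r" "d1 \<in> {1..9}" "d2 \<in> {1..9}" "d3 \<in> {1..9}"
      "r = 1 \<and> n = 1 \<or> r = 11 \<and> n = 2" for d1 d2 d3 r n :: nat
  proof -
    have "r = (10 ^ n - 1) div 9" "1 \<le> n"
      using that(5) by auto
    then have "fib k = repdigit d1 1 * repdigit d2 1 * repdigit d3 n"
      using that(1) by (simp add: repdigit_def)
    with that(2-4) \<open>1 \<le> n\<close> show ?thesis
      by (intro exI [of _ d1] exI [of _ d2] exI [of _ d3] exI [of _ 1] exI [of _ n]) simp
  qed
  from k show ?product
    apply (elim insertE emptyE)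
    apply (rule product [of 1 1 1 1 1]; simp)
    apply (rule product [of 1 1 2 1 1]; simp)
    apply (rule product [of 1 1 3 1 1]; simp)
    apply (rule product [of 1 1 5 1 1]; simp)
    apply (rule product [of 1 1 8 1 1]; simp)
    apply (rule product [of 1 3 7 1 1]; simp)
    apply (rule product [of 1 1 5 11 2]; simp)
    apply (rule product [of 2 8 9 1 1]; simp)
    done
qed

end
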